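(* Let $\Delta$ be a first-order unification context and let $\Delta'$ be obtained from $\Delta$ by applying one of the saturation rules (i.e. all premises of the rule are in $\Delta$ and $\Delta'$ is $\Delta$ together with the rule's conclusion). Then $\Delta$ and $\Delta'$ have exactly the same unifiers.
   Context: Fix constructors $c,d,e$ (with arities), unification metavariables tagged contractive ($H^{\mathrm{con}}$) or recursive ($H^{\mathrm{rec}}$), and recursion constants $\underline r,\underline s,\underline t$. Contractive terms $U ::= c\,N_1\cdots N_n\mid H^{\mathrm{con}}$; recursive terms $N ::= \underline r\mid H^{\mathrm{rec}}$; $M$ denotes either. A unification context $\Delta$ is a finite collection of equations $U_1\doteq U_2$, equations $N_1\doteq N_2$, recursive definitions $\underline r=_dU$ (at most one per constant, all constants used being defined), and possibly the symbol $\mathrm{contra}$; contradiction-free if $\mathrm{contra}\notin\Delta$. $\mathrm{defs}(\Delta)$, $\mathrm{eqs}(\Delta)$, $UV(\Delta)$ denote its definitions, equations, and unification metavariables. Expansion: $\mathrm{exp}^\Delta_0(M)=\bot$; $\mathrm{exp}^\Delta_{k+1}(H^m)=H^m$; $\mathrm{exp}^\Delta_{k+1}(c\,N_1\cdots N_n)=c\,(\mathrm{exp}^\Delta_k(N_1))\cdots(\mathrm{exp}^\Delta_k(N_n))$; $\mathrm{exp}^\Delta_{k+1}(\underline r)=\mathrm{exp}^\Delta_{k+1}(U)$ for $\underline r=_dU\in\Delta$. $M\doteq M'$ holds in $\Delta$ if $\mathrm{exp}^\Delta_k(M)=\mathrm{exp}^\Delta_k(M')$ for all $k$. A substitution $\Gamma$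 is a contradiction-free unification context whose equations have the form $H^{\mathrm{con}}\doteq U$ or $H^{\mathrm{rec}}\doteq N$, each metavariable on a left side at most once; $\mathrm{dom}(\Gamma)$ is the set of left-side metavariables. $M[\Gamma]$ replaces each $H^m\in\mathrm{dom}(\Gamma)$ by its right-hand side. $\Delta[\Gamma]=\mathrm{defs}(\Gamma)\cup\{M[\Gamma]\doteq M'[\Gamma]\mid M\doteq M'\in\mathrm{eqs}(\Delta)\}\cup\{\underline r=_dU[\Gamma]\mid \underline r=_dU\in\mathrm{defs}(\Delta)\}$ (recursion constants renamed apart as needed). A unifier of contradiction-free $\Delta$ is a substitution $\Gamma$ with $\mathrm{dom}(\Gamma)=UV(\Delta)$ such that every equation of $\Delta[\Gamma]$ holds in $\Delta[\Gamma]$; contexts containing $\mathrm{contra}$ have no unifier. Saturation rules (premises $\Rightarrow$ conclusion): SIMP-F: $c\,N_1\cdots N_n\doteq d\,N'_1\cdots N'_m$ with $c\neq d$ $\Rightarrow\mathrm{contra}$. SIMP: $c\,N_1\cdots N_n\doteq c\,N'_1\cdots N'_n\Rightarrow N_1\doteq N'_1,\dots,N_n\doteq N'_n$. R-EXP: $\underline r\doteq\underline s$, $\underline r=_dU_1$, $\underline s=_dU_2\Rightarrow U_1\doteq U_2$. U-SYM: $U\doteq U'\Rightarrow U'\doteq U$. U-TRANS: $U_1\doteq U_2$, $U_2\doteq U_3\Rightarrow U_1\doteq U_3$. N-SYM and N-TRANS: the same for recursive terms. *)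

theory Defs
  imports Main
begin

datatype ('h, 'r) rterm =
    RConst 'r
  | RMeta 'h

datatype ('c, 'h, 'r) cterm =
    App 'c "('h, 'r) rterm list"
  | CMeta 'h

datatype ('c, 'h, 'r) equation =
    CEq "('c, 'h, 'r) cterm" "('c, 'h, 'r) cterm"
  | REq "('h, 'r) rterm" "('h, 'r) rterm"

datatype ('c, 'h, rconsts: 'r) item =
    Eqn "('c, 'h, 'r) equation"
  | Def 'r "('c, 'h, 'r) cterm"
  | Contra


type_synonym ('c, 'h, 'r) ctx = "('c, 'h, 'r) item set"

definition eqs :: "('c, 'h, 'r) ctx \<Rightarrow> ('c, 'h, 'r) equation set" where
  "eqs \<Delta> = {e. Eqn e \<in> \<Delta>}"

definition defs :: "('c, 'h, 'r) ctx \<Rightarrow> ('r \<times> ('c, 'h, 'r) cterm) set" where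
  "defs \<Delta> = {(r, U). Def r U \<in> \<Delta>}"

definition contradiction_free :: "('c, 'h, 'r) ctx \<Rightarrow> bool" where
  "contradiction_free \<Delta> \<longleftrightarrow> Contra \<notin> \<Delta>"

text \<open>The tag is part of a metavariable: the same name tagged contractive and
  tagged recursive gives two different metavariables.\<close>

datatype 'h mvar = Con 'h | Rec 'h

primrec UV_rterm :: "('h, 'r) rterm \<Rightarrow> 'h mvar set" where
  "UV_rterm (RConst r) = {}"
| "UV_rterm (RMeta H) = {Rec H}"

primrec UV_cterm :: "('c, 'h, 'r) cterm \<Rightarrow> 'h mvar set" where
  "UV_cterm (App c Ns) = (\<Union>N\<in>set Ns. UV_rterm N)"
| "UV_cterm (CMeta H) = {Con H}"

primrec UV_equation :: "('c, 'h, 'r) equation \<Rightarrow> 'h mvar set" where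
  "UV_equation (CEq U U') = UV_cterm U \<union> UV_cterm U'"
| "UV_equation (REq N N') = UV_rterm N \<union> UV_rterm N'"

primrec UV_item :: "('c, 'h, 'r) item \<Rightarrow> 'h mvar set" where
  "UV_item (Eqn e) = UV_equation e"
| "UV_item (Def r U) = UV_cterm U"
| "UV_item Contra = {}"

definition UV :: "('c, 'h, 'r) ctx \<Rightarrow> 'h mvar set" where
  "UV \<Delta> = (\<Union>i\<in>\<Delta>. UV_item i)"

primrec arity_ok_cterm :: "('c \<Rightarrow> nat) \<Rightarrow> ('c, 'h, 'r) cterm \<Rightarrow> bool" where
  "arity_ok_cterm ar (App c Ns) \<longleftrightarrow> length Ns = ar c"
| "arity_ok_cterm ar (CMeta H) \<longleftrightarrow> True"

primrec arity_ok_equation :: "('c \<Rightarrow> nat) \<Rightarrow> ('c, 'h, 'r) equation \<Rightarrow> bool" where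
  "arity_ok_equation ar (CEq U U') \<longleftrightarrow> arity_ok_cterm ar U \<and> arity_ok_cterm ar U'"
| "arity_ok_equation ar (REq N N') \<longleftrightarrow> True"

primrec arity_ok_item :: "('c \<Rightarrow> nat) \<Rightarrow> ('c, 'h, 'r) item \<Rightarrow> bool" where
  "arity_ok_item ar (Eqn e) \<longleftrightarrow> arity_ok_equation ar e"
| "arity_ok_item ar (Def r U) \<longleftrightarrow> arity_ok_cterm ar U"
| "arity_ok_item ar Contra \<longleftrightarrow> True"

text \<open>\<open>rconsts i\<close> is the set of recursion constants occurring anywhere in the item \<open>i\<close>
  (including a constant that \<open>i\<close> defines).\<close>

definition unification_context :: "('c \<Rightarrow> nat) \<Rightarrow> ('c, 'h, 'r) ctx \<Rightarrow> bool" where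
  "unification_context ar \<Delta> \<longleftrightarrow>
     finite \<Delta> \<and>
     (\<forall>i\<in>\<Delta>. arity_ok_item ar i) \<and>
     (\<forall>r U U'. (r, U) \<in> defs \<Delta> \<longrightarrow> (r, U') \<in> defs \<Delta> \<longrightarrow> U = U') \<and>
     (\<forall>i\<in>\<Delta>. \<forall>r\<in>rconsts i. \<exists>U. (r, U) \<in> defs \<Delta>)"

datatype ('c, 'h) expansion =
    Bot
  | Node 'c "('c, 'h) expansion list"
  | Meta "'h mvar"

text \<open>Well-defined in unification contexts, where every constant has exactly one definition.\<close>

definition def_of :: "('c, 'h, 'r) ctx \<Rightarrow> 'r \<Rightarrow> ('c, 'h, 'r) cterm" where
  "def_of \<Delta> r = (THE U. (r, U) \<in> defs \<Delta>)"

fun exp_cterm :: "('c, 'h, 'r) ctx \<Rightarrow> nat \<Rightarrow> ('c, 'h, 'r) cterm \<Rightarrow> ('c, 'h) expansion"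
  and exp_rterm :: "('c, 'h, 'r) ctx \<Rightarrow> nat \<Rightarrow> ('h, 'r) rterm \<Rightarrow> ('c, 'h) expansion" where
  "exp_cterm \<Delta> 0 U = Bot"
| "exp_cterm \<Delta> (Suc k) (CMeta H) = Meta (Con H)"
| "exp_cterm \<Delta> (Suc k) (App c Ns) = Node c (map (exp_rterm \<Delta> k) Ns)"
| "exp_rterm \<Delta> 0 N = Bot"
| "exp_rterm \<Delta> (Suc k) (RMeta H) = Meta (Rec H)"
| "exp_rterm \<Delta> (Suc k) (RConst r) = exp_cterm \<Delta> (Suc k) (def_of \<Delta> r)"

primrec holds :: "('c, 'h, 'r) ctx \<Rightarrow> ('c, 'h, 'r) equation \<Rightarrow> bool" where
  "holds \<Delta> (CEq U U') \<longleftrightarrow> (\<forall>k. exp_cterm \<Delta> k U = exp_cterm \<Delta> k U')"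
| "holds \<Delta> (REq N N') \<longleftrightarrow> (\<forall>k. exp_rterm \<Delta> k N = exp_rterm \<Delta> k N')"

definition substitution :: "('c \<Rightarrow> nat) \<Rightarrow> ('c, 'h, 'r) ctx \<Rightarrow> bool" where
  "substitution ar \<Gamma> \<longleftrightarrow>
     unification_context ar \<Gamma> \<and>
     contradiction_free \<Gamma> \<and>
     (\<forall>e\<in>eqs \<Gamma>. (\<exists>H U. e = CEq (CMeta H) U) \<or> (\<exists>H N. e = REq (RMeta H) N)) \<and>
     (\<forall>H U U'. CEq (CMeta H) U \<in> eqs \<Gamma> \<longrightarrow> CEq (CMeta H) U' \<in> eqs \<Gamma> \<longrightarrow> U = U') \<and>
     (\<forall>H N N'. REq (RMeta H) N \<in> eqs \<Gamma> \<longrightarrow> REq (RMeta H) N' \<in> eqs \<Gamma> \<longrightarrow> N = N')"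

definition sdom :: "('c, 'h, 'r) ctx \<Rightarrow> 'h mvar set" where
  "sdom \<Gamma> = {Con H |H. \<exists>U. CEq (CMeta H) U \<in> eqs \<Gamma>} \<union>
            {Rec H |H. \<exists>N. REq (RMeta H) N \<in> eqs \<Gamma>}"

primrec subst_rterm :: "('c, 'h, 'r) ctx \<Rightarrow> ('h, 'r) rterm \<Rightarrow> ('h, 'r) rterm" where
  "subst_rterm \<Gamma> (RConst r) = RConst r"
| "subst_rterm \<Gamma> (RMeta H) =
     (if Rec H \<in> sdom \<Gamma> then THE N. REq (RMeta H) N \<in> eqs \<Gamma> else RMeta H)"

primrec subst_cterm :: "('c, 'h, 'r) ctx \<Rightarrow> ('c, 'h, 'r) cterm \<Rightarrow> ('c, 'h, 'r) cterm" where
  "subst_cterm \<Gamma> (App c Ns) = App c (map (subst_rterm \<Gamma>) Ns)"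
| "subst_cterm \<Gamma> (CMeta H) =
     (if Con H \<in> sdom \<Gamma> then THE U. CEq (CMeta H) U \<in> eqs \<Gamma> else CMeta H)"

primrec subst_equation ::
  "('c, 'h, 'r) ctx \<Rightarrow> ('c, 'h, 'r) equation \<Rightarrow> ('c, 'h, 'r) equation" where
  "subst_equation \<Gamma> (CEq U U') = CEq (subst_cterm \<Gamma> U) (subst_cterm \<Gamma> U')"
| "subst_equation \<Gamma> (REq N N') = REq (subst_rterm \<Gamma> N) (subst_rterm \<Gamma> N')"

text \<open>\<open>subst_ctx \<Delta> \<Gamma>\<close> is \<open>\<Delta>[\<Gamma>]\<close> for \<open>\<Delta>\<close> and \<open>\<Gamma>\<close> whose recursion constants are
  already apart.\<close>

definition subst_ctx :: "('c, 'h, 'r) ctx \<Rightarrow> ('c, 'h, 'r) ctx \<Rightarrow> ('c, 'h, 'r) ctx" where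
  "subst_ctx \<Delta> \<Gamma> =
     {Def r U |r U. (r, U) \<in> defs \<Gamma>} \<union>
     {Eqn (subst_equation \<Gamma> e) |e. e \<in> eqs \<Delta>} \<union>
     {Def r (subst_cterm \<Gamma> U) |r U. (r, U) \<in> defs \<Delta>}"

definition rename_ctx :: "('r \<Rightarrow> 's) \<Rightarrow> ('c, 'h, 'r) ctx \<Rightarrow> ('c, 'h, 's) ctx" where
  "rename_ctx \<rho> \<Delta> = map_item id id \<rho> ` \<Delta>"

text \<open>\<open>\<Delta>[\<Gamma>]\<close> in general. The constants of \<open>\<Delta>\<close> and \<open>\<Gamma>\<close> are renamed apart by injecting
  them into the two summands of \<open>'r + 'r\<close>, so no supply of fresh constants in \<open>'r\<close> has to be
  assumed. Both contexts define all the constants they use, so a constant occurring in both is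
  an accidental clash of names and not a reference from one to the other.\<close>

definition instantiate :: "('c, 'h, 'r) ctx \<Rightarrow> ('c, 'h, 'r) ctx \<Rightarrow> ('c, 'h, 'r + 'r) ctx" where
  "instantiate \<Delta> \<Gamma> = subst_ctx (rename_ctx Inl \<Delta>) (rename_ctx Inr \<Gamma>)"

definition unifier :: "('c \<Rightarrow> nat) \<Rightarrow> ('c, 'h, 'r) ctx \<Rightarrow> ('c, 'h, 'r) ctx \<Rightarrow> bool" where
  "unifier ar \<Delta> \<Gamma> \<longleftrightarrow>
     contradiction_free \<Delta> \<and>
     substitution ar \<Gamma> \<and>
     sdom \<Gamma> = UV \<Delta> \<and>
     (\<forall>e\<in>eqs (instantiate \<Delta> \<Gamma>). holds (instantiate \<Delta> \<Gamma>) e)"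

text \<open>\<open>saturation_rule P C\<close>: an instance of a rule with set of premises \<open>P\<close> and set of
  conclusions \<open>C\<close>.\<close>

inductive saturation_rule :: "('c, 'h, 'r) item set \<Rightarrow> ('c, 'h, 'r) item set \<Rightarrow> bool" where
  SIMP_F: "c \<noteq> d \<Longrightarrow> saturation_rule {Eqn (CEq (App c Ns) (App d Ns'))} {Contra}"
| SIMP: "length Ns = length Ns' \<Longrightarrow>
    saturation_rule {Eqn (CEq (App c Ns) (App c Ns'))}
      {Eqn (REq (Ns ! i) (Ns' ! i)) |i. i < length Ns}"
| R_EXP: "saturation_rule {Eqn (REq (RConst r) (RConst s)), Def r U1, Def s U2} {Eqn (CEq U1 U2)}"
| U_SYM: "saturation_rule {Eqn (CEq U U')} {Eqn (CEq U' U)}"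
| U_TRANS: "saturation_rule {Eqn (CEq U1 U2), Eqn (CEq U2 U3)} {Eqn (CEq U1 U3)}"
| N_SYM: "saturation_rule {Eqn (REq N N')} {Eqn (REq N' N)}"
| N_TRANS: "saturation_rule {Eqn (REq N1 N2), Eqn (REq N2 N3)} {Eqn (REq N1 N3)}"

definition saturation_step :: "('c, 'h, 'r) ctx \<Rightarrow> ('c, 'h, 'r) ctx \<Rightarrow> bool" where
  "saturation_step \<Delta> \<Delta>' \<longleftrightarrow> (\<exists>P C. saturation_rule P C \<and> P \<subseteq> \<Delta> \<and> \<Delta>' = \<Delta> \<union> C)"

end

theory Submission
  imports Defs
begin

text \<open>The definitions of \<open>\<Delta>[\<Gamma>]\<close> do not depend on the equations of \<open>\<Delta>\<close>, so adding a
  conclusion changes neither the expansions nor which equations hold. It therefore suffices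
  that, in the fixed context \<open>\<Delta>[\<Gamma>]\<close>, equality of all expansions is closed under the rules,
  and that no conclusion mentions a new metavariable.\<close>

lemma exp_cong:
  assumes "defs D = defs D'"
  shows "exp_cterm D k U = exp_cterm D' k U" and "exp_rterm D k N = exp_rterm D' k N"
  using assms
  by (induction D k U and D k N rule: exp_cterm_exp_rterm.induct) (simp_all add: def_of_def)

lemma holds_cong: "defs D = defs D' \<Longrightarrow> holds D e = holds D' e"
  by (cases e) (simp_all add: exp_cong[of D D'])

lemma holds_AppD:
  assumes "holds D (CEq (App c Ns) (App d Ns'))"
  shows "c = d" and "i < length Ns \<Longrightarrow> holds D (REq (Ns ! i) (Ns' ! i))"
proof -
  \<comment> \<open>Depth 0 gives \<open>Bot\<close> on both sides and says nothing. Depth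
    \<open>Suc k\<close> exposes the head and the arguments expanded to depth \<open>k\<close>, for
    every \<open>k\<close>.\<close>
  have "exp_cterm D (Suc k) (App c Ns) = exp_cterm D (Suc k) (App d Ns')" for k
    using assms by (simp del: exp_cterm.simps)
  then have cd: "c = d" and args: "map (exp_rterm D k) Ns = map (exp_rterm D k) Ns'" for k
    by auto
  show "c = d"
    by (fact cd)
  show "holds D (REq (Ns ! i) (Ns' ! i))" if "i < length Ns"
    using that args by (metis holds.simps(2) length_map nth_map)
qed

text \<open>The effect of \<Delta>[\<Gamma>] on a single equation of \<Delta>, with the same
  renaming apart as in \<open>instantiate\<close>. It lets the unifier condition range over
  \<open>eqs \<Delta>\<close> itself.\<close>

definition inst_equation ::
  "('c, 'h, 'r) ctx \<Rightarrow> ('c, 'h, 'r) equation \<Rightarrow> ('c, 'h, 'r + 'r) equation" where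
  "inst_equation \<Gamma> e = subst_equation (rename_ctx Inr \<Gamma>) (map_equation id id Inl e)"

lemma eqs_rename_ctx: "eqs (rename_ctx \<rho> \<Delta>) = map_equation id id \<rho> ` eqs \<Delta>"
proof -
  have "Eqn e = map_item id id \<rho> i \<longleftrightarrow> (\<exists>e'. i = Eqn e' \<and> e = map_equation id id \<rho> e')" for e i
    by (cases i) auto
  then show ?thesis
    by (auto simp: eqs_def rename_ctx_def image_iff)
qed

lemma defs_rename_ctx:
  "defs (rename_ctx \<rho> \<Delta>) = (\<lambda>(r, U). (\<rho> r, map_cterm id id \<rho> U)) ` defs \<Delta>"
proof -
  have iff: "Def r U = map_item id id \<rho> i \<longleftrightarrow>
      (\<exists>r' U'. i = Def r' U' \<and> r = \<rho> r' \<and> U = map_cterm id id \<rho> U')" for r U i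
    by (cases i) auto
  have "(r, U) \<in> defs (rename_ctx \<rho> \<Delta>) \<longleftrightarrow>
      (\<exists>i\<in>\<Delta>. Def r U = map_item id id \<rho> i)" for r U
    by (simp only: defs_def rename_ctx_def image_iff mem_Collect_eq prod.case)
  also have "\<dots> r U \<longleftrightarrow>
      (\<exists>r' U'. (r', U') \<in> defs \<Delta> \<and> r = \<rho> r' \<and> U = map_cterm id id \<rho> U')" for r U
    unfolding iff defs_def by blast
  finally show ?thesis
    by (simp add: set_eq_iff image_iff Bex_def)
qed

lemma eqs_instantiate: "eqs (instantiate \<Delta> \<Gamma>) = inst_equation \<Gamma> ` eqs \<Delta>"
proof -
  have "eqs (instantiate \<Delta> \<Gamma>) =
      subst_equation (rename_ctx Inr \<Gamma>) ` eqs (rename_ctx Inl \<Delta>)"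
    by (auto simp: instantiate_def subst_ctx_def eqs_def)
  then show ?thesis
    by (auto simp: eqs_rename_ctx inst_equation_def)
qed

text \<open>Only \<open>defs \<Delta>\<close> enters on the right, so adding equations to \<Delta>
  leaves all expansions after instantiation unchanged.\<close>

lemma defs_instantiate:
  "defs (instantiate \<Delta> \<Gamma>) = defs (rename_ctx Inr \<Gamma>) \<union>
    (\<lambda>(r, U). (Inl r, subst_cterm (rename_ctx Inr \<Gamma>) (map_cterm id id Inl U))) ` defs \<Delta>"
proof -
  have "defs (instantiate \<Delta> \<Gamma>) = defs (rename_ctx Inr \<Gamma>) \<union>
      (\<lambda>(r, U). (r, subst_cterm (rename_ctx Inr \<Gamma>) U)) ` defs (rename_ctx Inl \<Delta>)"
    by (auto simp: instantiate_def subst_ctx_def defs_def)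
  then show ?thesis
    by (simp add: defs_rename_ctx image_image case_prod_unfold)
qed

text \<open>Just one term fits the description \<open>THE\<close> in \<open>def_of\<close>:
  definitions from \<Gamma> carry an \<open>Inr\<close> constant and cannot clash with
  \<open>Inl r\<close>, and \<Delta> defines \<open>r\<close> at most once.\<close>

lemma def_of_instantiate:
  assumes "unification_context ar \<Delta>" and "Def r U \<in> \<Delta>"
  shows "def_of (instantiate \<Delta> \<Gamma>) (Inl r) =
    subst_cterm (rename_ctx Inr \<Gamma>) (map_cterm id id Inl U)"
proof -
  have "(r, U') \<in> defs \<Delta> \<longleftrightarrow> U' = U" for U'
    using assms by (auto simp: unification_context_def defs_def)
  then show ?thesis
    unfolding def_of_def defs_instantiate defs_rename_ctx
    by (intro the_equality) force+
qed

lemma unifier_iff: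
  "unifier ar \<Delta> \<Gamma> \<longleftrightarrow> Contra \<notin> \<Delta> \<and> substitution ar \<Gamma> \<and> sdom \<Gamma> = UV \<Delta> \<and>
    (\<forall>e\<in>eqs \<Delta>. holds (instantiate \<Delta> \<Gamma>) (inst_equation \<Gamma> e))"
  by (simp add: unifier_def contradiction_free_def eqs_instantiate)

lemma defs_saturation_conclusion: "saturation_rule P C \<Longrightarrow> defs C = {}"
  by (induction rule: saturation_rule.induct) (auto simp: defs_def)

text \<open>The domain of a unifier must be exactly \<open>UV\<close>. Every term of a conclusion
  occurs in a premise: as an argument for \<open>SIMP\<close>, and in a definition, whose
  metavariables \<open>UV\<close> also counts, for \<open>R_EXP\<close>.\<close>

lemma UV_saturation_conclusion: "saturation_rule P C \<Longrightarrow> UV C \<subseteq> UV P"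
proof (induction rule: saturation_rule.induct)
  case (SIMP Ns Ns' c)
  then show ?case
    by (fastforce simp: UV_def)
qed (auto simp: UV_def)

text \<open>Equality at all depths is an equivalence relation, which settles symmetry and
  transitivity. The \<open>SIMP\<close> rules rest on the injectivity and distinctness of tree
  nodes, \<open>R_EXP\<close> on a constant expanding exactly as its definition does.\<close>

lemma saturation_rule_sound:
  assumes "saturation_rule P C"
    and "unification_context ar \<Delta>" and "P \<subseteq> \<Delta>"
    and "\<And>e. Eqn e \<in> P \<Longrightarrow> holds (instantiate \<Delta> \<Gamma>) (inst_equation \<Gamma> e)"
  shows "Contra \<notin> C \<and> (\<forall>e\<in>eqs C. holds (instantiate \<Delta> \<Gamma>) (inst_equation \<Gamma> e))"
  using assms
proof (induction rule: saturation_rule.induct)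
  case (SIMP_F c d Ns Ns')
  \<comment> \<open>Instantiation keeps the head constructors, so the instantiated premise can hold
    only if they agree.\<close>
  from SIMP_F(4)[of "CEq (App c Ns) (App d Ns')"] have "c = d"
    by (auto simp: inst_equation_def simp del: holds.simps dest: holds_AppD(1))
  with \<open>c \<noteq> d\<close> show ?case
    by contradiction
next
  case (SIMP Ns Ns' c)
  let ?\<sigma> = "\<lambda>N. subst_rterm (rename_ctx Inr \<Gamma>) (map_rterm id Inl N)"
  have "holds (instantiate \<Delta> \<Gamma>) (CEq (App c (map ?\<sigma> Ns)) (App c (map ?\<sigma> Ns')))"
    using SIMP(4)[of "CEq (App c Ns) (App c Ns')"]
    by (simp add: inst_equation_def comp_def del: holds.simps)
  from holds_AppD(2)[OF this] show ?case
    using \<open>length Ns = length Ns'\<close>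
    by (auto simp: eqs_def inst_equation_def simp del: holds.simps)
next
  case (R_EXP r s U1 U2)
  let ?D = "instantiate \<Delta> \<Gamma>"
  have "exp_rterm ?D k (RConst (Inl r)) = exp_rterm ?D k (RConst (Inl s))" for k
    using R_EXP(3)[of "REq (RConst r) (RConst s)"] by (simp add: inst_equation_def)
  \<comment> \<open>Depth 0 gives \<open>Bot\<close> on both sides. At a positive depth, unfolding a
    constant consumes no depth, so \<open>k\<close> is the same for the constant and its
    definition.\<close>
  then have "exp_cterm ?D k (def_of ?D (Inl r)) = exp_cterm ?D k (def_of ?D (Inl s))" for k
    by (cases k) (simp, metis exp_rterm.simps(3))
  moreover have "Def r U1 \<in> \<Delta>" and "Def s U2 \<in> \<Delta>"
    using R_EXP(2) by auto
  ultimately show ?case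
    by (simp add: def_of_instantiate[OF R_EXP(1) \<open>Def r U1 \<in> \<Delta>\<close>]
        def_of_instantiate[OF R_EXP(1) \<open>Def s U2 \<in> \<Delta>\<close>] eqs_def inst_equation_def)
next
  case (U_TRANS U1 U2 U3)
  from U_TRANS(3)[of "CEq U1 U2"] U_TRANS(3)[of "CEq U2 U3"] show ?case
    by (simp add: eqs_def inst_equation_def)
next
  case (N_TRANS N1 N2 N3)
  from N_TRANS(3)[of "REq N1 N2"] N_TRANS(3)[of "REq N2 N3"] show ?case
    by (simp add: eqs_def inst_equation_def)
qed (auto simp: eqs_def inst_equation_def)

theorem theorem2p5:
  fixes ar :: "'c \<Rightarrow> nat"
    and \<Delta> \<Delta>' :: "('c, 'h, 'r) ctx"
  assumes "unification_context ar \<Delta>"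
    and "saturation_step \<Delta> \<Delta>'"
  shows "{\<Gamma>. unifier ar \<Delta> \<Gamma>} = {\<Gamma>. unifier ar \<Delta>' \<Gamma>}"
proof -
  obtain P C where rule: "saturation_rule P C" and "P \<subseteq> \<Delta>" and \<Delta>': "\<Delta>' = \<Delta> \<union> C"
    using assms(2) by (auto simp: saturation_step_def)
  have "UV P \<subseteq> UV \<Delta>"
    using \<open>P \<subseteq> \<Delta>\<close> by (auto simp: UV_def)
  with UV_saturation_conclusion[OF rule] have UV: "UV \<Delta>' = UV \<Delta>"
    by (auto simp: \<Delta>' UV_def)
  have "defs \<Delta>' = defs \<Delta>"
    using defs_saturation_conclusion[OF rule] by (auto simp: \<Delta>' defs_def)
  then have holds: "holds (instantiate \<Delta>' \<Gamma>) = holds (instantiate \<Delta> \<Gamma>)" for \<Gamma>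
    by (intro ext holds_cong) (simp add: defs_instantiate)
  have Contra: "Contra \<in> \<Delta>' \<longleftrightarrow> Contra \<in> \<Delta> \<or> Contra \<in> C"
    by (simp add: \<Delta>')
  have eqs: "eqs \<Delta>' = eqs \<Delta> \<union> eqs C"
    by (auto simp: \<Delta>' eqs_def)
  \<comment> \<open>Soundness serves the passage from \<Delta> to \<Delta>'. The converse is
    immediate, since \<Delta>' only adds conditions once domains and expansions are known to
    agree.\<close>
  have "Contra \<notin> C \<and> (\<forall>e\<in>eqs C. holds (instantiate \<Delta> \<Gamma>) (inst_equation \<Gamma> e))"
    if "unifier ar \<Delta> \<Gamma>" for \<Gamma>
    using that \<open>P \<subseteq> \<Delta>\<close>
    by (intro saturation_rule_sound[OF rule assms(1)]) (auto simp: unifier_iff eqs_def)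
  then have "unifier ar \<Delta> \<Gamma> \<longleftrightarrow> unifier ar \<Delta>' \<Gamma>" for \<Gamma>
    by (auto simp: unifier_iff UV holds eqs Contra)
  then show ?thesis
    by simp
qed

end
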